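(* Suppose the functions $p_v$ ($v\in V$) satisfy Assumption 1 (stated in the context). Then the problem (PA) $$\max_{\boldsymbol x\in\mathbb R^V,\ \boldsymbol z\in\mathbb R_{\ge0}^E}\ \sum_{e=(u,v)\in E}(x_v+w_e)z_e$$ subject to $x_v\in\mathcal X_v$ for all $v\in V$, $\ \sum_{e\in\delta(v)}z_e\le\bar\xi_v(x_v)$ for all $v\in V$, and $\ \sum_{e\in\delta(u)}z_e\le c_u$ for all $u\in U$, has an optimal solution.
   Context: $G=(U,V,E)$ is a finite bipartite graph with edges $e=(u,v)$, $u\in U$, $v\in V$; $\delta(a)$ is the set of edges incident to node $a$, assumed non-empty for every $a\in U\cup V$. Each edge $e$ has a weight $w_e\in\mathbb R$; each $u\in U$ has a capacity $c_u\in\mathbb Z_{>0}$. For each $v\in V$: $n_v$ is a non-negative integer, $\mathcal X_v\subseteq\mathbb R$ is an interval, $p_v:\mathcal X_v\to\mathcal Z_v\subseteq[0,1]$ is a real-valued function, and $\bar\xi_v(x):=n_vp_v(x)$. It is assumed that for each $v\in V$ there is $x_v\in\mathcal X_v$ with $x_v>-\max_{e\in\delta(v)}w_e$. Assumption 1. For all $v\in V$: (a) $p_v$ is a differentiable, strictly decreasing, and bijective function (from $\mathcal X_v$ onto $\mathcal Z_v$); (b) when $\mathcal X_v$ is bounded from above, $p_v(\max\mathcal X_v)=0$; when $\mathcal X_v$ is unbounded from above, $\lim_{x\to\infty}p_v(x)=0$; (c) $p_v'(x)/p_v(x)$ is monotonically non-increasing for all $x$ in the interior of $\mathcal X_v$,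 where $p_v'$ is the derivative of $p_v$.
   Formalization: The intervals X_v are additionally assumed closed (possibly unbounded); with an open lower end the claim fails, e.g. one edge with w=2, c=1, n=1, p(x)=exp(-x) on (0,∞), where the supremum 2 is not attained. *)

theory Defs
  imports "HOL-Analysis.Analysis"
begin

text \<open>
  A bipartite graph has left nodes \<open>U :: 'u set\<close>, right nodes \<open>V :: 'v set\<close> (of separate types,
  hence disjoint) and edges \<open>E \<subseteq> U \<times> V\<close>.
\<close>

definition edges_at_left :: "('u \<times> 'v) set \<Rightarrow> 'u \<Rightarrow> ('u \<times> 'v) set" where
  "edges_at_left E u = {e \<in> E. fst e = u}"

definition edges_at_right :: "('u \<times> 'v) set \<Rightarrow> 'v \<Rightarrow> ('u \<times> 'v) set" where
  "edges_at_right E v = {e \<in> E. snd e = v}"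

text \<open>
  Differentiability is relative to \<open>X\<close>, hence one-sided at an endpoint; \<open>deriv\<close> is only used in the
  interior, where the relative and the ordinary derivative agree. The two clauses on \<open>bdd_above\<close>
  describe the upper end of \<open>X\<close>; when \<open>X\<close> is bounded above, a maximum is required to exist.
\<close>

definition assumption1 :: "real set \<Rightarrow> real set \<Rightarrow> (real \<Rightarrow> real) \<Rightarrow> bool" where
  "assumption1 X Z p \<longleftrightarrow>
     p differentiable_on X \<and> strict_antimono_on X p \<and> bij_betw p X Z \<and>
     (bdd_above X \<longrightarrow> (\<exists>m\<in>X. (\<forall>x\<in>X. x \<le> m) \<and> p m = 0)) \<and>
     (\<not> bdd_above X \<longrightarrow> (p \<longlongrightarrow> 0) at_top) \<and>
     antimono_on (interior X) (\<lambda>x. deriv p x / p x)"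

definition xi_bar :: "('v \<Rightarrow> nat) \<Rightarrow> ('v \<Rightarrow> real \<Rightarrow> real) \<Rightarrow> 'v \<Rightarrow> real \<Rightarrow> real" where
  "xi_bar n p v x = real (n v) * p v x"

text \<open>
  The vector spaces indexed by the nodes in \<open>V\<close> and by the edges in \<open>E\<close> are represented by
  extensional functions.
\<close>

definition PA_feasible ::
  "'u set \<Rightarrow> 'v set \<Rightarrow> ('u \<times> 'v) set \<Rightarrow> ('u \<Rightarrow> int) \<Rightarrow> ('v \<Rightarrow> nat) \<Rightarrow> ('v \<Rightarrow> real set) \<Rightarrow>
   ('v \<Rightarrow> real \<Rightarrow> real) \<Rightarrow> (('v \<Rightarrow> real) \<times> ('u \<times> 'v \<Rightarrow> real)) set" where
  "PA_feasible U V E c n X p =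
     {(x, z). x \<in> V \<rightarrow>\<^sub>E UNIV \<and> z \<in> E \<rightarrow>\<^sub>E {0..} \<and>
        (\<forall>v\<in>V. x v \<in> X v) \<and>
        (\<forall>v\<in>V. (\<Sum>e\<in>edges_at_right E v. z e) \<le> xi_bar n p v (x v)) \<and>
        (\<forall>u\<in>U. (\<Sum>e\<in>edges_at_left E u. z e) \<le> of_int (c u))}"

definition PA_objective ::
  "('u \<times> 'v) set \<Rightarrow> ('u \<times> 'v \<Rightarrow> real) \<Rightarrow> ('v \<Rightarrow> real) \<times> ('u \<times> 'v \<Rightarrow> real) \<Rightarrow> real" where
  "PA_objective E w = (\<lambda>(x, z). \<Sum>(u, v)\<in>E. (x v + w (u, v)) * z (u, v))"

text \<open>
  The domains of the \<open>p v\<close> are closed intervals of the real line, possibly unbounded on either side. At the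
  upper end, \<^const>\<open>assumption1\<close> already forces this. At the lower end an open interval must be
  excluded, for otherwise the supremum of the objective need not be attained: take a single edge of weight 2,
  capacity 1, \<open>n = 1\<close>, and \<open>p x = exp (- x)\<close> on \<open>{0<..}\<close>, where the supremum 2 is approached only
  for \<open>x\<close> tending to 0.
\<close>

definition closed_interval :: "real set \<Rightarrow> bool" where
  "closed_interval X \<longleftrightarrow> is_interval X \<and> closed X"

end

theory Submission
  imports Defs "HOL-Real_Asymp.Real_Asymp"
begin

text \<open>
  The feasible set is not compact, because a price \<open>x v\<close> may run off to \<open>-\<infinity>\<close> or to \<open>+\<infinity>\<close>.
  Prices below \<open>- max w\<close> can be discarded: every edge at such a node earns at most zero, so it may
  just as well carry no flow. For prices tending to \<open>+\<infinity>\<close>, log-concavity of \<open>p v\<close> (part (c) of the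
  assumption) makes \<open>p v\<close> decay exponentially, so that not only \<open>p v x\<close> but also \<open>x * p v x\<close>
  tends to zero (\<open>log_concave_revenue_vanishes\<close>).

  This suggests recording, instead of the price \<open>x\<close>, the point \<open>(a, b) = (p v x, x * p v x)\<close> of
  demand and revenue per customer. Since \<open>X v\<close> is closed, these points form a compact curve once the
  origin is added as the point at infinity (\<open>compact_revenue_curve\<close>). Writing the flow on an edge \<open>e\<close> at \<open>v\<close> as the
  fraction \<open>y e\<close> of the available demand, \<open>z e = n v * a * y e\<close>, turns the profit
  \<open>(x + w e) * z e\<close> into \<open>n v * (b + w e * a) * y e\<close>, which is continuous in \<open>(a, b)\<close> and \<open>y\<close>, and the
  constraints into closed conditions on a compact set. Hence the reformulated problem has an
  optimal solution (\<open>curve_problem_attains_max\<close>). It translates back with the same objective value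
  (\<open>curve_feasible_realised\<close>): a node placed at the origin
  carries no flow, so any admissible price will do there. Conversely each feasible
  solution of the original problem is dominated by one of the reformulated problem
  (\<open>feasible_dominated_by_curve\<close>).
\<close>

section \<open>Decay of the revenue at high prices\<close>

text \<open>
  The logarithmic derivative \<open>p' / p\<close> is negative at some point, since \<open>p\<close> decreases. Being
  non-increasing, it stays below that negative constant \<open>-k\<close> from there on, so \<open>p x * exp (k * x)\<close> is
  non-increasing.
\<close>

lemma log_concave_revenue_vanishes:
  fixes p :: "real \<Rightarrow> real"
  assumes diff: "\<And>x. x > a \<Longrightarrow> p differentiable at x"
    and pos: "\<And>x. x > a \<Longrightarrow> p x > 0"
    and anti: "strict_antimono_on {a<..} p"
    and conc: "antimono_on {a<..} (\<lambda>x. deriv p x / p x)"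
  shows "((\<lambda>x. x * p x) \<longlongrightarrow> 0) at_top"
proof -
  have D: "(p has_real_derivative deriv p x) (at x)" if "x > a" for x
    using diff[OF that] by (simp add: DERIV_deriv_iff_real_differentiable)
  have "\<exists>x0>a. deriv p x0 < 0"
  proof (rule ccontr)
    assume "\<not> (\<exists>x0>a. deriv p x0 < 0)"
    then have d: "deriv p x \<ge> 0" if "x > a" for x
      using that by (meson not_less)
    have "p (a + 1) \<le> p (a + 2)"
    proof (rule DERIV_nonneg_imp_nondecreasing[of _ _ p])
      fix x assume "a + 1 \<le> x"
      then have "x > a" by simp
      then show "\<exists>y. (p has_real_derivative y) (at x) \<and> y \<ge> 0"
        using D d by blast
    qed simp
    moreover have "p (a + 2) < p (a + 1)"
      using anti by (simp add: monotone_on_def)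
    ultimately show False by simp
  qed
  then obtain x0 where x0: "x0 > a" "deriv p x0 < 0" by blast
  define k where "k = - (deriv p x0 / p x0)"
  have k: "k > 0"
    using x0 pos[OF x0(1)] by (simp add: k_def divide_neg_pos)
  define C where "C = p x0 * exp (k * x0)"
  have bound: "p x \<le> C * exp (- k * x)" if "x \<ge> x0" for x
  proof -
    have "p x * exp (k * x) \<le> p x0 * exp (k * x0)"
    proof (rule DERIV_nonpos_imp_nonincreasing[OF that])
      fix t assume t: "x0 \<le> t" "t \<le> x"
      have "deriv p t / p t \<le> - k"
        using conc t x0 unfolding k_def monotone_on_def by auto
      then have le: "deriv p t + k * p t \<le> 0"
        using pos[of t] t x0 by (simp add: field_simps)
      have "((\<lambda>s. p s * exp (k * s)) has_real_derivative (deriv p t + k * p t) * exp (k * t)) (at t)"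
        using D[of t] t x0 by (auto intro!: derivative_eq_intros simp: algebra_simps)
      moreover have "(deriv p t + k * p t) * exp (k * t) \<le> 0"
        using le by (simp add: mult_nonpos_nonneg)
      ultimately show "\<exists>y. ((\<lambda>s. p s * exp (k * s)) has_real_derivative y) (at t) \<and> y \<le> 0"
        by blast
    qed
    then show ?thesis
      by (simp add: C_def exp_minus field_simps)
  qed
  have lim: "((\<lambda>x. C * x * exp (- k * x)) \<longlongrightarrow> 0) at_top"
    using k by real_asymp
  show ?thesis
  proof (rule tendsto_sandwich[OF _ _ tendsto_const lim])
    show "\<forall>\<^sub>F x in at_top. 0 \<le> x * p x"
      using eventually_gt_at_top[of "max a 0"]
      by eventually_elim (use pos in \<open>force intro: mult_nonneg_nonneg less_imp_le\<close>)
    show "\<forall>\<^sub>F x in at_top. x * p x \<le> C * x * exp (- k * x)"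
      using eventually_ge_at_top[of "max x0 0"]
    proof eventually_elim
      case (elim x)
      then have "x * p x \<le> x * (C * exp (- k * x))"
        by (intro mult_left_mono bound) auto
      then show ?case by (simp add: mult_ac)
    qed
  qed
qed

section \<open>The revenue curve\<close>

definition revenue_point :: "(real \<Rightarrow> real) \<Rightarrow> real \<Rightarrow> real \<times> real" where
  "revenue_point p x = (p x, x * p x)"

definition revenue_curve :: "real set \<Rightarrow> (real \<Rightarrow> real) \<Rightarrow> real \<Rightarrow> (real \<times> real) set" where
  "revenue_curve X p l = insert (0, 0) (revenue_point p ` (X \<inter> {l..}))"

text \<open>
  One member of an open cover contains \<open>l\<close> and hence the image of all sufficiently large elements
  of \<open>S\<close>; the remaining elements of \<open>S\<close> form a compact set. Intersecting \<open>at_top\<close> with \<open>S\<close> makes the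
  limit hypothesis vacuous when \<open>S\<close> is bounded above.
\<close>

lemma compact_insert_limit_image:
  fixes f :: "real \<Rightarrow> 'b :: topological_space"
  assumes "closed S" "bdd_below S" and cont: "continuous_on S f"
    and lim: "(f \<longlongrightarrow> l) (inf at_top (principal S))"
  shows "compact (insert l (f ` S))"
proof (rule compactI)
  fix C assume C: "\<forall>t\<in>C. open t" "insert l (f ` S) \<subseteq> \<Union>C"
  then obtain T where T: "T \<in> C" "l \<in> T" by blast
  then have "\<forall>\<^sub>F x in at_top. x \<in> S \<longrightarrow> f x \<in> T"
    using lim C(1) by (auto simp: tendsto_def eventually_inf_principal)
  then obtain M where M: "\<And>x. x \<ge> M \<Longrightarrow> x \<in> S \<Longrightarrow> f x \<in> T"
    by (auto simp: eventually_at_top_linorder)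
  obtain m where m: "\<And>x. x \<in> S \<Longrightarrow> m \<le> x"
    using \<open>bdd_below S\<close> by (auto simp: bdd_below_def)
  have "S \<inter> {..M} = S \<inter> {m..M}" using m by auto
  then have "compact (S \<inter> {..M})"
    using \<open>closed S\<close> by (simp add: closed_Int_compact)
  then have "compact (f ` (S \<inter> {..M}))"
    by (intro compact_continuous_image continuous_on_subset[OF cont]) auto
  then obtain C' where C': "C' \<subseteq> C" "finite C'" "f ` (S \<inter> {..M}) \<subseteq> \<Union>C'"
    using C by (elim compactE[where \<T> = C]) auto
  have "insert l (f ` S) \<subseteq> \<Union>(insert T C')"
  proof
    fix q assume "q \<in> insert l (f ` S)"
    then consider "q = l" | x where "x \<in> S" "x \<le> M" "q = f x" | x where "x \<in> S" "x \<ge> M" "q = f x"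
      by force
    then show "q \<in> \<Union>(insert T C')"
      using C'(3) T(2) M by cases auto
  qed
  then show "\<exists>C'\<subseteq>C. finite C' \<and> insert l (f ` S) \<subseteq> \<Union>C'"
    using C' T by (intro exI[of _ "insert T C'"]) auto
qed

lemma assumption1_nonneg:
  assumes "assumption1 X Z p" "Z \<subseteq> {0..1}" "x \<in> X"
  shows "p x \<ge> 0"
proof -
  have "bij_betw p X Z"
    using assms(1) by (simp add: assumption1_def)
  then have "p x \<in> Z"
    using assms(3) by (rule bij_betw_apply)
  then show ?thesis using assms(2) by auto
qed

text \<open>
  If \<open>X\<close> is unbounded above, it contains a half-line. There \<open>p\<close> is positive, being non-negative and
  strictly decreasing, so log-concavity makes the revenue points converge to the origin. If \<open>X\<close> is bounded above,
  there are no high prices to control.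
\<close>

lemma compact_revenue_curve:
  assumes "closed_interval X" "assumption1 X Z p" "Z \<subseteq> {0..1}"
  shows "compact (revenue_curve X p l)"
proof -
  note A = assms(2)[unfolded assumption1_def]
  have X: "is_interval X" "closed X"
    using assms(1) by (auto simp: closed_interval_def)
  have nonneg: "p x \<ge> 0" if "x \<in> X" for x
    using assumption1_nonneg[OF assms(2,3) that] .
  have cont: "continuous_on X p"
    using A by (auto intro: differentiable_imp_continuous_on)
  have lim: "(revenue_point p \<longlongrightarrow> (0, 0)) (inf at_top (principal (X \<inter> {l..})))"
  proof (cases "bdd_above X")
    case True
    then obtain M where "\<And>x. x \<in> X \<Longrightarrow> x \<le> M" by (auto simp: bdd_above_def)
    then have "\<forall>\<^sub>F x in at_top. x \<notin> X"
      using eventually_gt_at_top[of M] by (auto elim!: eventually_mono simp: not_le[symmetric])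
    then show ?thesis
      by (auto simp: tendsto_def eventually_inf_principal elim: eventually_mono)
  next
    case False
    then have unb: "\<exists>y\<in>X. M < y" for M
      by (force simp: bdd_above_def not_le)
    then obtain a where a: "a \<in> X" by blast
    have sub: "{a<..} \<subseteq> X"
    proof
      fix x assume "x \<in> {a<..}"
      moreover obtain y where "y \<in> X" "x < y" using unb by blast
      ultimately show "x \<in> X"
        using X(1) a unfolding is_interval_1 by (meson greaterThan_iff less_imp_le)
    qed
    then have int: "{a<..} \<subseteq> interior X"
      by (simp add: interior_maximal)
    have "((\<lambda>x. x * p x) \<longlongrightarrow> 0) at_top"
    proof (rule log_concave_revenue_vanishes)
      fix x assume x: "x > a"
      then show "p differentiable at x"
        using A sub int by (metis at_within_interior differentiable_on_def greaterThan_iff subsetD)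
      have "x \<in> X" "x + 1 \<in> X"
        using sub x by auto
      then have "p (x + 1) < p x"
        using A by (auto simp: monotone_on_def)
      moreover have "p (x + 1) \<ge> 0"
        using sub x by (intro nonneg) auto
      ultimately show "p x > 0" by simp
    next
      show "strict_antimono_on {a<..} p"
        using A sub by (meson monotone_on_subset)
      show "antimono_on {a<..} (\<lambda>x. deriv p x / p x)"
        using A int by (meson monotone_on_subset)
    qed
    moreover have "(p \<longlongrightarrow> 0) at_top"
      using A False by simp
    ultimately have "(revenue_point p \<longlongrightarrow> (0, 0)) at_top"
      unfolding revenue_point_def by (intro tendsto_Pair)
    then show ?thesis
      by (rule tendsto_mono[rotated]) simp
  qed
  show ?thesis
    unfolding revenue_curve_def
  proof (rule compact_insert_limit_image[OF _ _ _ lim])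
    show "closed (X \<inter> {l..})" using X(2) by auto
    show "bdd_below (X \<inter> {l..})" by auto
    show "continuous_on (X \<inter> {l..}) (revenue_point p)"
      unfolding revenue_point_def
      by (intro continuous_intros continuous_on_subset[OF cont]) auto
  qed
qed

section \<open>The reformulated problem\<close>

definition curve_feasible ::
  "'u set \<Rightarrow> 'v set \<Rightarrow> ('u \<times> 'v) set \<Rightarrow> ('u \<Rightarrow> int) \<Rightarrow> ('v \<Rightarrow> nat) \<Rightarrow> ('v \<Rightarrow> (real \<times> real) set) \<Rightarrow>
   (('v \<Rightarrow> real \<times> real) \<times> ('u \<times> 'v \<Rightarrow> real)) set" where
  "curve_feasible U V E c n \<Gamma> =
     {(q, y). q \<in> V \<rightarrow>\<^sub>E UNIV \<and> y \<in> E \<rightarrow>\<^sub>E {0..1} \<and>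
        (\<forall>v\<in>V. q v \<in> \<Gamma> v) \<and>
        (\<forall>v\<in>V. (\<Sum>e\<in>edges_at_right E v. y e) \<le> 1) \<and>
        (\<forall>u\<in>U. (\<Sum>e\<in>edges_at_left E u. real (n (snd e)) * fst (q (snd e)) * y e) \<le> of_int (c u))}"

definition curve_objective ::
  "('u \<times> 'v) set \<Rightarrow> ('u \<times> 'v \<Rightarrow> real) \<Rightarrow> ('v \<Rightarrow> nat) \<Rightarrow>
   ('v \<Rightarrow> real \<times> real) \<times> ('u \<times> 'v \<Rightarrow> real) \<Rightarrow> real" where
  "curve_objective E w n = (\<lambda>(q, y).
     \<Sum>e\<in>E. real (n (snd e)) * (snd (q (snd e)) + w e * fst (q (snd e))) * y e)"

text \<open>
  Tychonoff's theorem for extensional functions: outside the index set \<open>I\<close> the only value is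
  \<open>undefined\<close>, and a singleton is compact.
\<close>

lemma compact_PiE:
  fixes K :: "'i \<Rightarrow> 'a :: topological_space set"
  assumes "\<And>i. i \<in> I \<Longrightarrow> compact (K i)"
  shows "compact (PiE I K)"
proof -
  have eq: "PiE I K = PiE UNIV (\<lambda>i. if i \<in> I then K i else {undefined})"
    by (auto simp: PiE_iff extensional_def split: if_splits)
  have "compactin (product_topology (\<lambda>i. euclidean) UNIV)
          (PiE UNIV (\<lambda>i. if i \<in> I then K i else {undefined}))"
    using assms by (auto simp: compactin_PiE)
  then show ?thesis
    by (simp add: eq euclidean_product_topology)
qed

lemma continuous_on_fst_apply [continuous_intros]:
  "continuous_on S (\<lambda>s. fst s i)" for S :: "(('i \<Rightarrow> 'a :: topological_space) \<times> 'b :: topological_space) set"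
  by (rule continuous_on_product_then_coordinatewise[OF continuous_on_fst[OF continuous_on_id]])

lemma continuous_on_snd_apply [continuous_intros]:
  "continuous_on S (\<lambda>s. snd s i)" for S :: "('b :: topological_space \<times> ('i \<Rightarrow> 'a :: topological_space)) set"
  by (rule continuous_on_product_then_coordinatewise[OF continuous_on_snd[OF continuous_on_id]])

text \<open>
  The objective and the constraints are polynomial in the coordinates of \<open>q\<close> and \<open>y\<close>, hence continuous
  for the product topology. Zero fractions with all nodes at the origin respect every capacity, so
  the feasible set is non-empty.
\<close>

lemma curve_problem_attains_max:
  assumes compact: "\<And>v. v \<in> V \<Longrightarrow> compact (\<Gamma> v)"
    and zero: "\<And>v. v \<in> V \<Longrightarrow> (0, 0) \<in> \<Gamma> v"
    and cap: "\<And>u. u \<in> U \<Longrightarrow> c u \<ge> 0"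
  shows "\<exists>s\<in>curve_feasible U V E c n \<Gamma>. \<forall>t\<in>curve_feasible U V E c n \<Gamma>.
           curve_objective E w n t \<le> curve_objective E w n s"
proof (rule continuous_attains_sup)
  have "curve_feasible U V E c n \<Gamma> =
      (PiE V \<Gamma> \<times> (E \<rightarrow>\<^sub>E {0..1})) \<inter>
      ((\<Inter>v\<in>V. {s. (\<Sum>e\<in>edges_at_right E v. snd s e) \<le> 1}) \<inter>
       (\<Inter>u\<in>U. {s. (\<Sum>e\<in>edges_at_left E u. real (n (snd e)) * fst (fst s (snd e)) * snd s e)
                   \<le> of_int (c u)}))"
    unfolding curve_feasible_def
    by (rule set_eqI)
      (simp only: mem_Collect_eq case_prod_unfold Int_iff mem_Times_iff INT_iff PiE_iff UNIV_I, blast)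
  moreover have "compact (PiE V \<Gamma> \<times> (E \<rightarrow>\<^sub>E {0..1::real}))"
    by (intro compact_Times compact_PiE compact) auto
  ultimately show "compact (curve_feasible U V E c n \<Gamma>)"
    by (simp only:)
      (intro compact_Int_closed closed_Int closed_INT ballI closed_Collect_le continuous_intros)
  have "(\<lambda>v\<in>V. (0, 0), \<lambda>e\<in>E. 0) \<in> curve_feasible U V E c n \<Gamma>"
    using zero cap by (auto simp: curve_feasible_def edges_at_left_def edges_at_right_def
        intro!: order_trans[OF eq_refl[OF sum.neutral]])
  then show "curve_feasible U V E c n \<Gamma> \<noteq> {}" by blast
  show "continuous_on (curve_feasible U V E c n \<Gamma>) (curve_objective E w n)"
    unfolding curve_objective_def case_prod_unfold by (intro continuous_intros)
qed

section \<open>Translation between the two problems\<close>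

text \<open>
  The hypothesis \<open>X v \<inter> {l v..} \<noteq> {}\<close> supplies the price for a node placed at the origin of its
  curve.
\<close>

lemma curve_feasible_realised:
  assumes E: "E \<subseteq> U \<times> V"
    and nonneg: "\<And>v x. v \<in> V \<Longrightarrow> x \<in> X v \<Longrightarrow> p v x \<ge> 0"
    and nonempty: "\<And>v. v \<in> V \<Longrightarrow> X v \<inter> {l v..} \<noteq> {}"
    and feas: "(q, y) \<in> curve_feasible U V E c n (\<lambda>v. revenue_curve (X v) (p v) (l v))"
  shows "\<exists>x z. (x, z) \<in> PA_feasible U V E c n X p \<and>
           PA_objective E w (x, z) = curve_objective E w n (q, y)"
proof -
  have "\<exists>x\<in>X v. 0 \<le> fst (q v) \<and> fst (q v) \<le> p v x \<and> x * fst (q v) = snd (q v)" if v: "v \<in> V" for v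
  proof -
    consider "q v = (0, 0)" | x where "x \<in> X v" "q v = revenue_point (p v) x"
      using feas v by (auto simp: curve_feasible_def revenue_curve_def)
    then show ?thesis
    proof cases
      case 1
      then show ?thesis using nonempty[OF v] nonneg[OF v] by auto
    next
      case 2
      then show ?thesis using nonneg[OF v] by (auto simp: revenue_point_def)
    qed
  qed
  then obtain x where x: "\<And>v. v \<in> V \<Longrightarrow> x v \<in> X v" "\<And>v. v \<in> V \<Longrightarrow> 0 \<le> fst (q v)"
    "\<And>v. v \<in> V \<Longrightarrow> fst (q v) \<le> p v (x v)" "\<And>v. v \<in> V \<Longrightarrow> x v * fst (q v) = snd (q v)"
    by metis
  define z where "z = (\<lambda>e\<in>E. real (n (snd e)) * fst (q (snd e)) * y e)"
  have VE: "snd e \<in> V" if "e \<in> E" for e using that E by auto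
  have y: "0 \<le> y e" if "e \<in> E" for e using feas that by (auto simp: curve_feasible_def)
  have "(\<Sum>e\<in>edges_at_right E v. z e) \<le> xi_bar n p v (x v)" if v: "v \<in> V" for v
  proof -
    have "(\<Sum>e\<in>edges_at_right E v. z e) = real (n v) * fst (q v) * (\<Sum>e\<in>edges_at_right E v. y e)"
      unfolding sum_distrib_left by (rule sum.cong) (auto simp: z_def edges_at_right_def)
    also have "\<dots> \<le> real (n v) * fst (q v) * 1"
      using feas v x(2)[OF v] by (intro mult_left_mono) (auto simp: curve_feasible_def)
    also have "\<dots> \<le> xi_bar n p v (x v)"
      using x(3)[OF v] by (simp add: xi_bar_def mult_left_mono)
    finally show ?thesis .
  qed
  moreover have "(\<Sum>e\<in>edges_at_left E u. z e) \<le> of_int (c u)" if u: "u \<in> U" for u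
  proof -
    have "(\<Sum>e\<in>edges_at_left E u. z e) =
        (\<Sum>e\<in>edges_at_left E u. real (n (snd e)) * fst (q (snd e)) * y e)"
      by (rule sum.cong) (auto simp: z_def edges_at_left_def)
    then show ?thesis using feas u by (auto simp: curve_feasible_def)
  qed
  moreover have "z e \<ge> 0" if "e \<in> E" for e
    using that x(2)[OF VE] y by (auto simp: z_def)
  ultimately have "(restrict x V, z) \<in> PA_feasible U V E c n X p"
    using x(1) by (auto simp: PA_feasible_def z_def)
  moreover have "PA_objective E w (restrict x V, z) = curve_objective E w n (q, y)"
    unfolding PA_objective_def curve_objective_def case_prod_unfold fst_conv snd_conv prod.collapse
    using x(4) E by (intro sum.cong refl) (auto simp: z_def algebra_simps)
  ultimately show ?thesis by blast
qed

text \<open>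
  A node whose price lies below \<open>l v\<close> moves to the origin of its curve and gives up its flow,
  which earned at most zero.
\<close>

lemma feasible_dominated_by_curve:
  assumes fin: "finite E" and E: "E \<subseteq> U \<times> V"
    and nonneg: "\<And>v x. v \<in> V \<Longrightarrow> x \<in> X v \<Longrightarrow> p v x \<ge> 0"
    and l: "\<And>e. e \<in> E \<Longrightarrow> l (snd e) \<le> - w e"
    and feas: "(x, z) \<in> PA_feasible U V E c n X p"
  shows "\<exists>s\<in>curve_feasible U V E c n (\<lambda>v. revenue_curve (X v) (p v) (l v)).
           PA_objective E w (x, z) \<le> curve_objective E w n s"
proof -
  define q where "q = (\<lambda>v\<in>V. if x v \<ge> l v then revenue_point (p v) (x v) else (0, 0))"
  \<comment> \<open>If the demand is zero, so is the flow, and division by zero yields the fraction zero.\<close>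
  define y where "y = (\<lambda>e\<in>E. if x (snd e) \<ge> l (snd e) then z e / xi_bar n p (snd e) (x (snd e)) else 0)"
  have VE: "snd e \<in> V" if "e \<in> E" for e using that E by auto
  have z: "0 \<le> z e" if "e \<in> E" for e using feas that by (auto simp: PA_feasible_def)
  have xX: "x v \<in> X v" if "v \<in> V" for v using feas that by (auto simp: PA_feasible_def)
  have xi: "0 \<le> xi_bar n p v (x v)" if "v \<in> V" for v
    using nonneg[OF that xX[OF that]] by (simp add: xi_bar_def)
  have right: "(\<Sum>e\<in>edges_at_right E v. z e) \<le> xi_bar n p v (x v)" if "v \<in> V" for v
    using feas that by (auto simp: PA_feasible_def)
  have zle: "z e \<le> xi_bar n p (snd e) (x (snd e))" if e: "e \<in> E" for e
  proof -
    have "z e \<le> (\<Sum>e'\<in>edges_at_right E (snd e). z e')"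
      using fin e z by (intro member_le_sum) (auto simp: edges_at_right_def)
    also have "\<dots> \<le> xi_bar n p (snd e) (x (snd e))" by (rule right[OF VE[OF e]])
    finally show ?thesis .
  qed
  have yz: "xi_bar n p (snd e) (x (snd e)) * y e = z e" if "e \<in> E" "x (snd e) \<ge> l (snd e)" for e
    using that zle[of e] z[of e] by (auto simp: y_def)
  have y01: "0 \<le> y e \<and> y e \<le> 1" if "e \<in> E" for e
    using that zle[of e] z[of e] xi[OF VE, of e] by (auto simp: y_def divide_le_eq_1)
  have "(\<Sum>e\<in>edges_at_right E v. y e) \<le> 1" if v: "v \<in> V" for v
  proof (cases "x v \<ge> l v")
    case True
    then have "(\<Sum>e\<in>edges_at_right E v. y e) = (\<Sum>e\<in>edges_at_right E v. z e) / xi_bar n p v (x v)"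
      unfolding sum_divide_distrib by (intro sum.cong) (auto simp: y_def edges_at_right_def)
    also have "\<dots> \<le> 1" using right[OF v] xi[OF v] by (auto simp: divide_le_eq_1)
    finally show ?thesis .
  next
    case False
    then have "(\<Sum>e\<in>edges_at_right E v. y e) = 0"
      by (intro sum.neutral) (auto simp: y_def edges_at_right_def)
    then show ?thesis by simp
  qed
  moreover have "(\<Sum>e\<in>edges_at_left E u. real (n (snd e)) * fst (q (snd e)) * y e) \<le> of_int (c u)"
    if u: "u \<in> U" for u
  proof -
    have "(\<Sum>e\<in>edges_at_left E u. real (n (snd e)) * fst (q (snd e)) * y e)
        \<le> (\<Sum>e\<in>edges_at_left E u. z e)"
    proof (rule sum_mono)
      fix e assume "e \<in> edges_at_left E u"
      then have e: "e \<in> E" by (simp add: edges_at_left_def)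
      then show "real (n (snd e)) * fst (q (snd e)) * y e \<le> z e"
        using yz[OF e] z[OF e] VE[OF e] by (auto simp: q_def revenue_point_def xi_bar_def)
    qed
    also have "\<dots> \<le> of_int (c u)" using feas u by (auto simp: PA_feasible_def)
    finally show ?thesis .
  qed
  moreover have "q v \<in> revenue_curve (X v) (p v) (l v)" if "v \<in> V" for v
    using that xX by (auto simp: q_def revenue_curve_def)
  ultimately have "(q, y) \<in> curve_feasible U V E c n (\<lambda>v. revenue_curve (X v) (p v) (l v))"
    using y01 by (auto simp: curve_feasible_def q_def y_def)
  moreover have "PA_objective E w (x, z) \<le> curve_objective E w n (q, y)"
    unfolding PA_objective_def curve_objective_def case_prod_unfold fst_conv snd_conv prod.collapse
  proof (rule sum_mono)
    fix e assume e: "e \<in> E"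
    show "(x (snd e) + w e) * z e
        \<le> real (n (snd e)) * (snd (q (snd e)) + w e * fst (q (snd e))) * y e"
    proof (cases "x (snd e) \<ge> l (snd e)")
      case True
      then show ?thesis
        using VE[OF e] unfolding yz[OF e True, symmetric]
        by (simp add: q_def revenue_point_def xi_bar_def algebra_simps)
    next
      case False
      then have "(x (snd e) + w e) * z e \<le> 0"
        using l[OF e] z[OF e] by (intro mult_nonpos_nonneg) auto
      then show ?thesis using False VE[OF e] by (simp add: q_def)
    qed
  qed
  ultimately show ?thesis by blast
qed

section \<open>Existence of an optimal solution\<close>

theorem lemma3:
  fixes U :: "'u set" and V :: "'v set" and E :: "('u \<times> 'v) set"
    and w :: "'u \<times> 'v \<Rightarrow> real" and c :: "'u \<Rightarrow> int" and n :: "'v \<Rightarrow> nat"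
    and X Z :: "'v \<Rightarrow> real set" and p :: "'v \<Rightarrow> real \<Rightarrow> real"
  assumes "finite U" and "finite V" and "E \<subseteq> U \<times> V"
    and "\<And>u. u \<in> U \<Longrightarrow> edges_at_left E u \<noteq> {}"
    and "\<And>v. v \<in> V \<Longrightarrow> edges_at_right E v \<noteq> {}"
    and "\<And>u. u \<in> U \<Longrightarrow> c u > 0"
    and "\<And>v. v \<in> V \<Longrightarrow> closed_interval (X v)"
    and "\<And>v. v \<in> V \<Longrightarrow> Z v \<subseteq> {0..1}"
    and "\<And>v. v \<in> V \<Longrightarrow> \<exists>x\<in>X v. x > - (MAX e\<in>edges_at_right E v. w e)"
    and "\<And>v. v \<in> V \<Longrightarrow> assumption1 (X v) (Z v) (p v)"
  shows "\<exists>x z. is_arg_max (PA_objective E w) (\<lambda>s. s \<in> PA_feasible U V E c n X p) (x, z)"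
proof -
  define l where "l v = - (MAX e\<in>edges_at_right E v. w e)" for v
  define \<Gamma> where "\<Gamma> v = revenue_curve (X v) (p v) (l v)" for v
  have fin: "finite E"
    using assms(1-3) by (meson finite_SigmaI finite_subset)
  have l: "l (snd e) \<le> - w e" if "e \<in> E" for e
    using fin that by (auto simp: l_def edges_at_right_def intro!: Max_ge)
  have nonneg: "p v x \<ge> 0" if "v \<in> V" "x \<in> X v" for v x
    using assumption1_nonneg[OF assms(10,8) that(2)] that(1) by blast
  have nonempty: "X v \<inter> {l v..} \<noteq> {}" if "v \<in> V" for v
    using assms(9)[OF that] by (force simp: l_def)
  have "\<exists>s\<in>curve_feasible U V E c n \<Gamma>. \<forall>t\<in>curve_feasible U V E c n \<Gamma>.
           curve_objective E w n t \<le> curve_objective E w n s"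
  proof (rule curve_problem_attains_max)
    show "compact (\<Gamma> v)" if "v \<in> V" for v
      unfolding \<Gamma>_def using assms(7,10,8)[OF that] by (rule compact_revenue_curve)
  qed (use assms(6) in \<open>auto simp: \<Gamma>_def revenue_curve_def less_imp_le\<close>)
  then obtain q y where qy: "(q, y) \<in> curve_feasible U V E c n \<Gamma>"
    and max: "\<And>t. t \<in> curve_feasible U V E c n \<Gamma> \<Longrightarrow>
                curve_objective E w n t \<le> curve_objective E w n (q, y)"
    by force
  obtain x z where xz: "(x, z) \<in> PA_feasible U V E c n X p"
    "PA_objective E w (x, z) = curve_objective E w n (q, y)"
    using curve_feasible_realised[where X = X and p = p and l = l, OF assms(3) nonneg nonempty] qy
    unfolding \<Gamma>_def by blast
  have "PA_objective E w s \<le> PA_objective E w (x, z)" if feas: "s \<in> PA_feasible U V E c n X p" for s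
  proof -
    obtain x' z' where s: "s = (x', z')" by (cases s)
    obtain t where "t \<in> curve_feasible U V E c n \<Gamma>" "PA_objective E w s \<le> curve_objective E w n t"
      using feasible_dominated_by_curve[where X = X and p = p and l = l, OF fin assms(3) nonneg l] feas
      unfolding \<Gamma>_def s by blast
    then show ?thesis using max xz(2) by fastforce
  qed
  then have "is_arg_max (PA_objective E w) (\<lambda>s. s \<in> PA_feasible U V E c n X p) (x, z)"
    using xz(1) unfolding is_arg_max_def by (auto simp: not_less)
  then show ?thesis by blast
qed

end
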